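(* Let $(A,\lhd,\rhd)$ be a finite-dimensional pre-Novikov algebra over $\mathbf{k}$ and $(A,\circ)$ the associated Novikov algebra. Let $\{e_1,\ldots,e_n\}$ be a linear basis of $A$ and $\{e_1^*,\ldots,e_n^*\}$ the dual basis of $A^*$. Then $$r:=\sum_{\alpha=1}^n(e_\alpha\otimes e_\alpha^*-e_\alpha^*\otimes e_\alpha)$$ is a skewsymmetric solution of the Novikov Yang-Baxter equation in the Novikov algebra $A\ltimes_{L_\rhd^*+R_\lhd^*,-R_\lhd^*}A^*$. Moreover, $A\ltimes_{L_\rhd^*+R_\lhd^*,-R_\lhd^*}A^*$ with the bilinear form $$\omega(a+f,b+g)=\langle g,a\rangle-\langle f,b\rangle\qquad\text{for all }a,b\in A,\ f,g\in A^*,$$ is a quasi-Frobenius Novikov algebra.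
   Context: $\mathbf{k}$ is a field of characteristic zero. A Novikov algebra $(A,\circ)$: $(a\circ b)\circ c-a\circ(b\circ c)=(b\circ a)\circ c-b\circ(a\circ c)$ and $(a\circ b)\circ c=(a\circ c)\circ b$. A pre-Novikov algebra is a vector space $A$ with binary operations $\lhd,\rhd$ such that for all $x,y,z\in A$: $x\rhd(y\rhd z)=(x\rhd y+x\lhd y)\rhd z+y\rhd(x\rhd z)-(y\rhd x+y\lhd x)\rhd z$; $x\rhd(y\lhd z)=(x\rhd y)\lhd z+y\lhd(x\lhd z+x\rhd z)-(y\lhd x)\lhd z$; $(x\lhd y+x\rhd y)\rhd z=(x\rhd z)\lhd y$; $(x\lhd y)\lhd z=(x\lhd z)\lhd y$. Its associated Novikov algebra is $(A,\circ)$ with $x\circ y=x\lhd y+x\rhd y$. Put $L_\rhd(a)b=a\rhd b$, $R_\lhd(a)b=b\lhd a$; for $\varphi:A\to\mathrm{End}(A)$, $\langle\varphi^*(a)f,b\rangle=-\langle f,\varphi(a)b\rangle$. The Novikov algebra $A\ltimes_{L_\rhd^*+R_\lhd^*,-R_\lhd^*}A^*$ is $A\oplus A^*$ with product $(a+f)\bullet(b+g)=a\circ b+(L_\rhd^*+R_\lhd^* )(a)g-R_\lhd^*(b)f$. For a Novikov algebra $(N,\circ)$ and $r=\sum_\alpha x_\alpha\otimes y_\alpha\in N\otimes N$, the Novikov Yang-Baxter equation (NYBE) is $\sum_{\alpha,\beta}\big(x_\alpha\otimes x_\beta\otimes y_\alpha\circ y_\beta+x_\alpha\otimes(y_\alpha\circ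 x_\beta+x_\beta\circ y_\alpha)\otimes y_\beta+x_\alpha\circ x_\beta\otimes y_\beta\otimes y_\alpha\big)=0$. Skewsymmetric means $\tau r=-r$ for the flip $\tau$. A quasi-Frobenius Novikov algebra is a Novikov algebra $(N,\circ)$ with a skewsymmetric nondegenerate bilinear form $\omega$ such that $\omega(a\circ b,c)-\omega(a\circ c+c\circ a,b)+\omega(c\circ b,a)=0$ for all $a,b,c\in N$. *)

theory Defs
  imports
    Complex_Main
    "HOL-Library.Poly_Mapping"
    "HOL-Library.Function_Algebras"
    "HOL-Library.Product_Plus"
begin

text \<open>
  Algebras that occur as \<open>A \<oplus> A\<^sup>*\<close> live on a subspace \<open>N\<close> of a type, because the linear
  functionals with respect to a given scalar multiplication do not form a type.
\<close>

section \<open>Bilinear maps and algebras\<close>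

definition bilinear_on ::
  "'v set \<Rightarrow> ('k \<Rightarrow> 'v \<Rightarrow> 'v) \<Rightarrow> ('k \<Rightarrow> 'w \<Rightarrow> 'w) \<Rightarrow> ('v::plus \<Rightarrow> 'v \<Rightarrow> 'w::plus) \<Rightarrow> bool" where
  "bilinear_on N s t B \<longleftrightarrow>
     (\<forall>x\<in>N. \<forall>y\<in>N. \<forall>z\<in>N. B (x + y) z = B x z + B y z \<and> B z (x + y) = B z x + B z y) \<and>
     (\<forall>c. \<forall>x\<in>N. \<forall>y\<in>N. B (s c x) y = t c (B x y) \<and> B x (s c y) = t c (B x y))"

locale novikov_algebra = vector_space scale
  for scale :: "'k::field \<Rightarrow> 'v::ab_group_add \<Rightarrow> 'v" +
  fixes N :: "'v set"
    and mult :: "'v \<Rightarrow> 'v \<Rightarrow> 'v"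
  assumes subspace_carrier: "subspace N"
    and mult_closed: "\<lbrakk>a \<in> N; b \<in> N\<rbrakk> \<Longrightarrow> mult a b \<in> N"
    and mult_bilinear: "bilinear_on N scale scale mult"
    and left_symmetric: "\<lbrakk>a \<in> N; b \<in> N; c \<in> N\<rbrakk> \<Longrightarrow>
      mult (mult a b) c - mult a (mult b c) = mult (mult b a) c - mult b (mult a c)"
    and right_commutative: "\<lbrakk>a \<in> N; b \<in> N; c \<in> N\<rbrakk> \<Longrightarrow>
      mult (mult a b) c = mult (mult a c) b"

locale quasi_frobenius_novikov_algebra = novikov_algebra scale N mult
  for scale :: "'k::field \<Rightarrow> 'v::ab_group_add \<Rightarrow> 'v" and N mult +
  fixes \<omega> :: "'v \<Rightarrow> 'v \<Rightarrow> 'k"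
  assumes form_bilinear: "bilinear_on N scale (*) \<omega>"
    and form_skew: "\<lbrakk>a \<in> N; b \<in> N\<rbrakk> \<Longrightarrow> \<omega> a b = - \<omega> b a"
    and form_nondegenerate: "\<lbrakk>a \<in> N; \<And>b. b \<in> N \<Longrightarrow> \<omega> a b = 0\<rbrakk> \<Longrightarrow> a = 0"
    and form_compatible: "\<lbrakk>a \<in> N; b \<in> N; c \<in> N\<rbrakk> \<Longrightarrow>
      \<omega> (mult a b) c - \<omega> (mult a c + mult c a) b + \<omega> (mult c b) a = 0"

locale pre_novikov_algebra = vector_space scale
  for scale :: "'k::field \<Rightarrow> 'a::ab_group_add \<Rightarrow> 'a" +
  fixes lhd :: "'a \<Rightarrow> 'a \<Rightarrow> 'a"  (infixl "\<lhd>" 70)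
    and rhd :: "'a \<Rightarrow> 'a \<Rightarrow> 'a"  (infixl "\<rhd>" 70)
  assumes lhd_bilinear: "bilinear_on UNIV scale scale (\<lhd>)"
    and rhd_bilinear: "bilinear_on UNIV scale scale (\<rhd>)"
    and rhd_rhd: "x \<rhd> (y \<rhd> z) = (x \<rhd> y + x \<lhd> y) \<rhd> z + y \<rhd> (x \<rhd> z) - (y \<rhd> x + y \<lhd> x) \<rhd> z"
    and rhd_lhd: "x \<rhd> (y \<lhd> z) = (x \<rhd> y) \<lhd> z + y \<lhd> (x \<lhd> z + x \<rhd> z) - (y \<lhd> x) \<lhd> z"
    and add_rhd: "(x \<lhd> y + x \<rhd> y) \<rhd> z = (x \<rhd> z) \<lhd> y"
    and lhd_lhd: "(x \<lhd> y) \<lhd> z = (x \<lhd> z) \<lhd> y"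

definition assoc_mult :: "('a::plus \<Rightarrow> 'a \<Rightarrow> 'a) \<Rightarrow> ('a \<Rightarrow> 'a \<Rightarrow> 'a) \<Rightarrow> 'a \<Rightarrow> 'a \<Rightarrow> 'a" where
  "assoc_mult lhd rhd x y = lhd x y + rhd x y"


section \<open>The dual space and the semidirect product\<close>

definition dual_space :: "('k::field \<Rightarrow> 'a::ab_group_add \<Rightarrow> 'a) \<Rightarrow> ('a \<Rightarrow> 'k) set" where
  "dual_space scale = {f. Vector_Spaces.linear scale (*) f}"

definition dual_action ::
  "('a \<Rightarrow> 'a \<Rightarrow> 'a) \<Rightarrow> 'a \<Rightarrow> ('a \<Rightarrow> 'k::field) \<Rightarrow> 'a \<Rightarrow> 'k" where
  "dual_action \<phi> a f = (\<lambda>b. - f (\<phi> a b))"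

definition direct_sum_dual ::
  "('k::field \<Rightarrow> 'a::ab_group_add \<Rightarrow> 'a) \<Rightarrow> ('a \<times> ('a \<Rightarrow> 'k)) set" where
  "direct_sum_dual scale = UNIV \<times> dual_space scale"

definition direct_sum_scale ::
  "('k::field \<Rightarrow> 'a \<Rightarrow> 'a) \<Rightarrow> 'k \<Rightarrow> 'a \<times> ('a \<Rightarrow> 'k) \<Rightarrow> 'a \<times> ('a \<Rightarrow> 'k)" where
  "direct_sum_scale scale c = (\<lambda>(a, f). (scale c a, \<lambda>x. c * f x))"

definition semidirect_mult ::
  "('a \<Rightarrow> 'a \<Rightarrow> 'a) \<Rightarrow> ('a \<Rightarrow> 'v \<Rightarrow> 'v) \<Rightarrow> ('a \<Rightarrow> 'v \<Rightarrow> 'v::plus) \<Rightarrow> 'a \<times> 'v \<Rightarrow> 'a \<times> 'v \<Rightarrow> 'a \<times> 'v" where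
  "semidirect_mult mult l r = (\<lambda>(a, u) (b, v). (mult a b, l a v + r b u))"

text \<open>The product of \<open>A \<ltimes> A\<^sup>*\<close> with respect to \<open>L\<^sub>\<rhd>\<^sup>* + R\<^sub>\<lhd>\<^sup>*\<close> and \<open>- R\<^sub>\<lhd>\<^sup>*\<close>.\<close>

definition dual_semidirect_mult ::
  "('a::plus \<Rightarrow> 'a \<Rightarrow> 'a) \<Rightarrow> ('a \<Rightarrow> 'a \<Rightarrow> 'a) \<Rightarrow>
   'a \<times> ('a \<Rightarrow> 'k::field) \<Rightarrow> 'a \<times> ('a \<Rightarrow> 'k) \<Rightarrow> 'a \<times> ('a \<Rightarrow> 'k)" where
  "dual_semidirect_mult lhd rhd =
     (let L = (\<lambda>a b. rhd a b); R = (\<lambda>a b. lhd b a)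
      in semidirect_mult (assoc_mult lhd rhd)
           (\<lambda>a f. dual_action L a f + dual_action R a f)
           (\<lambda>a f. - dual_action R a f))"

definition dual_pairing_form :: "'a \<times> ('a \<Rightarrow> 'k::field) \<Rightarrow> 'a \<times> ('a \<Rightarrow> 'k) \<Rightarrow> 'k" where
  "dual_pairing_form = (\<lambda>(a, f) (b, g). g a - f b)"


section \<open>Tensor powers\<close>

text \<open>
  \<open>N \<otimes> N\<close> and \<open>N \<otimes> N \<otimes> N\<close> are the free vector spaces on \<open>N \<times> N\<close> and \<open>N \<times> N \<times> N\<close> modulo the
  subspace spanned by the multilinearity relations; a tensor is a coset.
\<close>

definition formal_scale :: "'k \<Rightarrow> ('x \<Rightarrow>\<^sub>0 'k) \<Rightarrow> ('x \<Rightarrow>\<^sub>0 'k::field)" where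
  "formal_scale c = Poly_Mapping.map ((*) c)"

lemma lookup_formal_scale [simp]: "Poly_Mapping.lookup (formal_scale c u) x = c * Poly_Mapping.lookup u x"
  by (simp add: formal_scale_def Poly_Mapping.map.rep_eq when_def)

interpretation formal: vector_space formal_scale
  by unfold_locales (auto intro!: poly_mapping_eqI simp: lookup_add algebra_simps)

definition formal_sums :: "'x set \<Rightarrow> ('x \<Rightarrow>\<^sub>0 'k::field) set" where
  "formal_sums X = {u. Poly_Mapping.keys u \<subseteq> X}"

abbreviation gen :: "'x \<Rightarrow> ('x \<Rightarrow>\<^sub>0 'k::field)" where
  "gen x \<equiv> Poly_Mapping.single x 1"

definition tensor_relations2 ::
  "('k::field \<Rightarrow> 'v \<Rightarrow> 'v) \<Rightarrow> 'v::plus set \<Rightarrow> ('v \<times> 'v \<Rightarrow>\<^sub>0 'k) set" where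
  "tensor_relations2 s N =
     {gen (x + x', y) - gen (x, y) - gen (x', y) | x x' y. x \<in> N \<and> x' \<in> N \<and> y \<in> N} \<union>
     {gen (x, y + y') - gen (x, y) - gen (x, y') | x y y'. x \<in> N \<and> y \<in> N \<and> y' \<in> N} \<union>
     {gen (s c x, y) - formal_scale c (gen (x, y)) | c x y. x \<in> N \<and> y \<in> N} \<union>
     {gen (x, s c y) - formal_scale c (gen (x, y)) | c x y. x \<in> N \<and> y \<in> N}"

definition tensor_relations3 ::
  "('k::field \<Rightarrow> 'v \<Rightarrow> 'v) \<Rightarrow> 'v::plus set \<Rightarrow> ('v \<times> 'v \<times> 'v \<Rightarrow>\<^sub>0 'k) set" where
  "tensor_relations3 s N =
     {gen (x + x', y, z) - gen (x, y, z) - gen (x', y, z) |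
        x x' y z. x \<in> N \<and> x' \<in> N \<and> y \<in> N \<and> z \<in> N} \<union>
     {gen (x, y + y', z) - gen (x, y, z) - gen (x, y', z) |
        x y y' z. x \<in> N \<and> y \<in> N \<and> y' \<in> N \<and> z \<in> N} \<union>
     {gen (x, y, z + z') - gen (x, y, z) - gen (x, y, z') |
        x y z z'. x \<in> N \<and> y \<in> N \<and> z \<in> N \<and> z' \<in> N} \<union>
     {gen (s c x, y, z) - formal_scale c (gen (x, y, z)) | c x y z. x \<in> N \<and> y \<in> N \<and> z \<in> N} \<union>
     {gen (x, s c y, z) - formal_scale c (gen (x, y, z)) | c x y z. x \<in> N \<and> y \<in> N \<and> z \<in> N} \<union>
     {gen (x, y, s c z) - formal_scale c (gen (x, y, z)) | c x y z. x \<in> N \<and> y \<in> N \<and> z \<in> N}"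

definition tensor_eq2 ::
  "('k::field \<Rightarrow> 'v \<Rightarrow> 'v) \<Rightarrow> 'v::plus set \<Rightarrow> ('v \<times> 'v \<Rightarrow>\<^sub>0 'k) rel" where
  "tensor_eq2 s N =
     {(u, v). u \<in> formal_sums (N \<times> N) \<and> v \<in> formal_sums (N \<times> N) \<and>
              u - v \<in> formal.span (tensor_relations2 s N)}"

definition tensor_eq3 ::
  "('k::field \<Rightarrow> 'v \<Rightarrow> 'v) \<Rightarrow> 'v::plus set \<Rightarrow> ('v \<times> 'v \<times> 'v \<Rightarrow>\<^sub>0 'k) rel" where
  "tensor_eq3 s N =
     {(u, v). u \<in> formal_sums (N \<times> N \<times> N) \<and> v \<in> formal_sums (N \<times> N \<times> N) \<and>
              u - v \<in> formal.span (tensor_relations3 s N)}"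

lemma equiv_tensor_eq2: "equiv (formal_sums (N \<times> N)) (tensor_eq2 s N)"
proof (rule equivI)
  show "sym (tensor_eq2 s N)"
    unfolding tensor_eq2_def by (rule symI) (auto dest: formal.span_neg)
  show "trans (tensor_eq2 s N)"
    unfolding tensor_eq2_def by (rule transI) (auto dest: formal.span_add)
qed (auto simp: tensor_eq2_def refl_on_def formal.span_zero)

lemma equiv_tensor_eq3: "equiv (formal_sums (N \<times> N \<times> N)) (tensor_eq3 s N)"
proof (rule equivI)
  show "sym (tensor_eq3 s N)"
    unfolding tensor_eq3_def by (rule symI) (auto dest: formal.span_neg)
  show "trans (tensor_eq3 s N)"
    unfolding tensor_eq3_def by (rule transI) (auto dest: formal.span_add)
qed (auto simp: tensor_eq3_def refl_on_def formal.span_zero)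

definition tensor_space2 ::
  "('k::field \<Rightarrow> 'v \<Rightarrow> 'v) \<Rightarrow> 'v::plus set \<Rightarrow> ('v \<times> 'v \<Rightarrow>\<^sub>0 'k) set set" where
  "tensor_space2 s N = formal_sums (N \<times> N) // tensor_eq2 s N"

definition tensor2 ::
  "('k::field \<Rightarrow> 'v \<Rightarrow> 'v) \<Rightarrow> 'v::plus set \<Rightarrow> ('v \<times> 'v \<Rightarrow>\<^sub>0 'k) \<Rightarrow> ('v \<times> 'v \<Rightarrow>\<^sub>0 'k) set" where
  "tensor2 s N u = tensor_eq2 s N `` {u}"

definition tensor3 ::
  "('k::field \<Rightarrow> 'v \<Rightarrow> 'v) \<Rightarrow> 'v::plus set \<Rightarrow>
   ('v \<times> 'v \<times> 'v \<Rightarrow>\<^sub>0 'k) \<Rightarrow> ('v \<times> 'v \<times> 'v \<Rightarrow>\<^sub>0 'k) set" where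
  "tensor3 s N u = tensor_eq3 s N `` {u}"

text \<open>
  Flip and negation act on a coset elementwise. Precomposition with \<^const>\<open>prod.swap\<close>, which is
  what \<^const>\<open>Poly_Mapping.map_key\<close> does, sends the generator \<open>(x, y)\<close> to \<open>(y, x)\<close>.
\<close>

definition skewsymmetric_tensor :: "('v \<times> 'v \<Rightarrow>\<^sub>0 'k::field) set \<Rightarrow> bool" where
  "skewsymmetric_tensor r \<longleftrightarrow> Poly_Mapping.map_key prod.swap ` r = uminus ` r"


section \<open>The Novikov Yang-Baxter equation\<close>

text \<open>A list of pairs \<open>(x\<^sub>\<alpha>, y\<^sub>\<alpha>)\<close> stands for the tensor \<open>\<Sum>\<^sub>\<alpha> x\<^sub>\<alpha> \<otimes> y\<^sub>\<alpha>\<close>.\<close>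

definition formal_of_pairs :: "('v \<times> 'v) list \<Rightarrow> ('v \<times> 'v \<Rightarrow>\<^sub>0 'k::field)" where
  "formal_of_pairs ps = (\<Sum>p\<leftarrow>ps. gen p)"

definition nybe_lhs ::
  "('v \<Rightarrow> 'v \<Rightarrow> 'v::plus) \<Rightarrow> ('v \<times> 'v) list \<Rightarrow> ('v \<times> 'v \<times> 'v \<Rightarrow>\<^sub>0 'k::field)" where
  "nybe_lhs mult ps =
     (\<Sum>(x, y)\<leftarrow>ps. \<Sum>(x', y')\<leftarrow>ps.
        gen (x, x', mult y y') +
        gen (x, mult y x' + mult x' y, y') +
        gen (mult x x', y', y))"

text \<open>
  For a product that is bilinear on \<open>N\<close>, the left-hand side of the equation depends only on the
  tensor, not on the way it is written as a sum of pure tensors, so quantifying over all such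
  presentations is harmless.
\<close>

definition nybe_solution ::
  "('k::field \<Rightarrow> 'v \<Rightarrow> 'v) \<Rightarrow> 'v::plus set \<Rightarrow> ('v \<Rightarrow> 'v \<Rightarrow> 'v) \<Rightarrow> ('v \<times> 'v \<Rightarrow>\<^sub>0 'k) set \<Rightarrow> bool" where
  "nybe_solution s N mult r \<longleftrightarrow>
     r \<in> tensor_space2 s N \<and>
     (\<forall>ps. set ps \<subseteq> N \<times> N \<and> r = tensor2 s N (formal_of_pairs ps) \<longrightarrow>
        tensor3 s N (nybe_lhs mult ps) = tensor3 s N 0)"

end

theory Submission
  imports Defs
begin

text \<open>
  The tensor \<open>r\<close> and the form \<open>\<omega>\<close> are inverse to each other: contracting the first leg of \<open>r\<close>
  with \<open>\<omega>(v, \<cdot>)\<close> and the second leg with \<open>\<omega>(w, \<cdot>)\<close> gives \<open>\<omega>(v, w)\<close>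
  (\<open>canonical_tensor_inverts_pairing\<close>). This is the expansion of a functional in a dual basis.
  
  For any quasi-Frobenius Novikov algebra, a tensor \<open>\<Sum> x\<^sub>i \<otimes> y\<^sub>i\<close> inverse to the form solves the Novikov
  Yang-Baxter equation (\<open>nybe_solution_inverse_form\<close>). Indeed nondegeneracy turns the inverse property
  into the two expansions \<open>v = \<Sum> \<omega>(v, y\<^sub>i) x\<^sub>i = \<Sum> \<omega>(x\<^sub>i, v) y\<^sub>i\<close>. They contract the left-hand side of the
  equation with \<open>\<omega>(\<cdot>, p) \<otimes> \<omega>(\<cdot>, q) \<otimes> \<omega>(\<cdot>, s)\<close> to
  \<open>\<omega>(p \<circ> q, s) - \<omega>(p \<circ> s + s \<circ> p, q) + \<omega>(s \<circ> q, p)\<close>,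
  which is zero by the compatibility of the form with the product. The same expansions show that the
  algebra is spanned by the \<open>x\<^sub>i\<close> with coefficients \<open>\<omega>(\<cdot>, y\<^sub>i)\<close>, so a threefold tensor all of whose
  contractions of this kind vanish is zero (\<open>in_span_tensor_relations3\<close>). Only the contractions of the
  twofold tensor enter, so the argument applies to every presentation of \<open>r\<close> as a sum of pure tensors.
  
  That the semidirect product is quasi-Frobenius (\<open>quasi_frobenius_semidirect_dual\<close>) is a direct
  computation: after evaluating functionals, each identity becomes a consequence of the
  pre-Novikov axioms.
\<close>

section \<open>Linear functionals on formal sums\<close>

definition formal_eval :: "('x \<Rightarrow> 'k::field) \<Rightarrow> ('x \<Rightarrow>\<^sub>0 'k) \<Rightarrow> 'k" where
  "formal_eval T u = (\<Sum>x\<in>Poly_Mapping.keys u. Poly_Mapping.lookup u x * T x)"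

lemma formal_eval_superset:
  assumes "finite X" "Poly_Mapping.keys u \<subseteq> X"
  shows "formal_eval T u = (\<Sum>x\<in>X. Poly_Mapping.lookup u x * T x)"
  unfolding formal_eval_def
  by (rule sum.mono_neutral_left) (use assms in \<open>auto simp: in_keys_iff\<close>)

lemma vector_space_field: "vector_space ((*) :: 'k::field \<Rightarrow> 'k \<Rightarrow> 'k)"
  by unfold_locales (auto simp: algebra_simps)

lemma linear_formal_eval: "Vector_Spaces.linear formal_scale (*) (formal_eval T)"
proof -
  have add: "formal_eval T (u + v) = formal_eval T u + formal_eval T v" for u v
  proof -
    let ?X = "Poly_Mapping.keys u \<union> Poly_Mapping.keys v"
    have "formal_eval T w = (\<Sum>x\<in>?X. Poly_Mapping.lookup w x * T x)"
      if "Poly_Mapping.keys w \<subseteq> ?X" for w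
      using that by (intro formal_eval_superset) auto
    then show ?thesis
      using Poly_Mapping.keys_add[of u v]
      by (simp add: lookup_add distrib_right sum.distrib)
  qed
  have scale: "formal_eval T (formal_scale c u) = c * formal_eval T u" for c u
  proof -
    have "Poly_Mapping.keys (formal_scale c u) \<subseteq> Poly_Mapping.keys u"
      by (auto simp: in_keys_iff)
    then have "formal_eval T (formal_scale c u)
        = (\<Sum>x\<in>Poly_Mapping.keys u. Poly_Mapping.lookup (formal_scale c u) x * T x)"
      by (intro formal_eval_superset) auto
    then show ?thesis
      by (simp add: formal_eval_def sum_distrib_left mult.assoc)
  qed
  show ?thesis
    unfolding Vector_Spaces.linear_iff
    using add scale formal.vector_space_axioms vector_space_field by blast
qed

lemmas formal_eval_add = module_hom.add[OF Vector_Spaces.linear.axioms(3)[OF linear_formal_eval]]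
  and formal_eval_diff = module_hom.diff[OF Vector_Spaces.linear.axioms(3)[OF linear_formal_eval]]
  and formal_eval_scale = module_hom.scale[OF Vector_Spaces.linear.axioms(3)[OF linear_formal_eval]]
  and formal_eval_sum = module_hom.sum[OF Vector_Spaces.linear.axioms(3)[OF linear_formal_eval]]
  and formal_eval_zero = module_hom.zero[OF Vector_Spaces.linear.axioms(3)[OF linear_formal_eval]]
  and formal_eval_eq_0_on_span =
    module_hom.eq_0_on_span[OF Vector_Spaces.linear.axioms(3)[OF linear_formal_eval]]

lemma formal_eval_gen [simp]: "formal_eval T (gen x) = T x"
  by (simp add: formal_eval_def)

lemma formal_eval_sum_list: "formal_eval T (\<Sum>x\<leftarrow>xs. F x) = (\<Sum>x\<leftarrow>xs. formal_eval T (F x))"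
  by (induction xs) (auto simp: formal_eval_add formal_eval_zero)

lemma formal_sum_expansion:
  "u = (\<Sum>x\<in>Poly_Mapping.keys u. formal_scale (Poly_Mapping.lookup u x) (gen x))"
  by (rule poly_mapping_eqI)
    (simp add: lookup_sum lookup_single when_def in_keys_iff if_distrib[of "(*) _"] cong: if_cong)

lemma subspace_formal_sums: "formal.subspace (formal_sums X :: ('x \<Rightarrow>\<^sub>0 'k::field) set)"
proof (rule formal.subspaceI)
  fix u v :: "'x \<Rightarrow>\<^sub>0 'k" and c
  assume "u \<in> formal_sums X"
  then have u: "Poly_Mapping.keys u \<subseteq> X"
    by (simp add: formal_sums_def)
  have "Poly_Mapping.keys (formal_scale c u) \<subseteq> Poly_Mapping.keys u"
    by (auto simp: in_keys_iff)
  then show "formal_scale c u \<in> formal_sums X"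
    using u by (auto simp: formal_sums_def)
  assume "v \<in> formal_sums X"
  then show "u + v \<in> formal_sums X"
    using u Poly_Mapping.keys_add[of u v] by (auto simp: formal_sums_def)
qed (simp add: formal_sums_def)

lemma gen_in_formal_sums [simp]: "gen x \<in> (formal_sums X :: ('x \<Rightarrow>\<^sub>0 'k::field) set) \<longleftrightarrow> x \<in> X"
  by (simp add: formal_sums_def)

lemma formal_sums_sum_list:
  "(\<And>x. x \<in> set xs \<Longrightarrow> F x \<in> formal_sums X) \<Longrightarrow> (\<Sum>x\<leftarrow>xs. F x) \<in> formal_sums X"
  by (induction xs)
    (auto intro: formal.subspace_add[OF subspace_formal_sums] formal.subspace_0[OF subspace_formal_sums])

text \<open>
  A bilinear form on \<open>N\<close> kills the defining relations of \<open>N \<otimes> N\<close>, hence its linear extension takes the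
  same value on all representatives of a tensor.
\<close>

lemma formal_eval_tensor_relations2:
  assumes B: "bilinear_on N s (*) B" and u: "u \<in> formal.span (tensor_relations2 s N)"
  shows "formal_eval (\<lambda>(x, y). B x y) u = 0"
proof (rule formal_eval_eq_0_on_span[OF _ u])
  fix w assume "w \<in> tensor_relations2 s N"
  then show "formal_eval (\<lambda>(x, y). B x y) w = 0"
    using B unfolding tensor_relations2_def bilinear_on_def
    by (auto simp: formal_eval_diff formal_eval_scale)
qed

section \<open>Detecting zero in a tensor cube\<close>

text \<open>
  A map that is linear modulo a subspace of relations commutes with linear combinations modulo that
  subspace. It is meant for \<open>v \<mapsto> v \<otimes> b \<otimes> c\<close> and the corresponding maps for the other two slots.
\<close>

lemma (in vector_space) linear_modulo_sum:
  fixes g :: "'b \<Rightarrow> ('x \<Rightarrow>\<^sub>0 'a)"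
  assumes N: "subspace N" and W: "formal.subspace W"
    and add: "\<And>x y. x \<in> N \<Longrightarrow> y \<in> N \<Longrightarrow> g (x + y) - g x - g y \<in> W"
    and scl: "\<And>c x. x \<in> N \<Longrightarrow> g (scale c x) - formal_scale c (g x) \<in> W"
    and x: "\<And>i. i \<in> I \<Longrightarrow> x i \<in> N"
  shows "g (\<Sum>i\<in>I. scale (c i) (x i)) - (\<Sum>i\<in>I. formal_scale (c i) (g (x i))) \<in> W"
proof -
  \<comment> \<open>The empty sum needs \<open>g 0 \<in> W\<close>, which is additivity at \<open>0 + 0\<close>.\<close>
  have "g (0 + 0) - g 0 - g 0 \<in> W"
    by (intro add subspace_0[OF N])
  then have zero: "g 0 \<in> W"
    using formal.subspace_neg[OF W] by fastforce
  show ?thesis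
    using x
  proof (induction I rule: infinite_finite_induct)
    case (insert i I)
    let ?s = "\<Sum>i\<in>I. scale (c i) (x i)" and ?t = "\<Sum>i\<in>I. formal_scale (c i) (g (x i))"
    have mem: "?s \<in> N" "scale (c i) (x i) \<in> N"
      using insert.prems by (auto intro!: subspace_sum[OF N] subspace_scale[OF N])
    have "(g (scale (c i) (x i) + ?s) - g (scale (c i) (x i)) - g ?s)
        + (g (scale (c i) (x i)) - formal_scale (c i) (g (x i))) + (g ?s - ?t) \<in> W"
      using insert mem by (intro formal.subspace_add[OF W] add scl) auto
    then show ?case
      using insert.hyps by (simp add: algebra_simps)
  qed (simp_all add: zero)
qed

lemma tensor_relations3_memI:
  assumes "x \<in> N" "y \<in> N" "z \<in> N"
  shows "x' \<in> N \<Longrightarrow> gen (x + x', y, z) - gen (x, y, z) - gen (x', y, z) \<in> tensor_relations3 s N"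
    and "y' \<in> N \<Longrightarrow> gen (x, y + y', z) - gen (x, y, z) - gen (x, y', z) \<in> tensor_relations3 s N"
    and "z' \<in> N \<Longrightarrow> gen (x, y, z + z') - gen (x, y, z) - gen (x, y, z') \<in> tensor_relations3 s N"
    and "gen (s c x, y, z) - formal_scale c (gen (x, y, z)) \<in> tensor_relations3 s N"
    and "gen (x, s c y, z) - formal_scale c (gen (x, y, z)) \<in> tensor_relations3 s N"
    and "gen (x, y, s c z) - formal_scale c (gen (x, y, z)) \<in> tensor_relations3 s N"
  unfolding tensor_relations3_def Un_iff mem_Collect_eq
  subgoal by (rule disjI1, rule disjI1, rule disjI1, rule disjI1, rule disjI1, intro exI conjI, rule refl, simp_all add: assms)
  subgoal by (rule disjI1, rule disjI1, rule disjI1, rule disjI1, rule disjI2, intro exI conjI, rule refl, simp_all add: assms)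
  subgoal by (rule disjI1, rule disjI1, rule disjI1, rule disjI2, intro exI conjI, rule refl, simp_all add: assms)
  subgoal by (rule disjI1, rule disjI1, rule disjI2, intro exI conjI, rule refl, simp_all add: assms)
  subgoal by (rule disjI1, rule disjI2, intro exI conjI, rule refl, simp_all add: assms)
  subgoal by (rule disjI2, intro exI conjI, rule refl, simp_all add: assms)
  done

lemma (in vector_space) gen_expansion3:
  fixes \<phi> :: "'i \<Rightarrow> 'b \<Rightarrow> 'a"
  assumes N: "subspace N"
    and x: "\<And>i. i \<in> I \<Longrightarrow> x i \<in> N"
    and expand: "\<And>v. v \<in> N \<Longrightarrow> v = (\<Sum>i\<in>I. scale (\<phi> i v) (x i))"
    and abc: "a \<in> N" "b \<in> N" "c \<in> N"
  shows "gen (a, b, c) - (\<Sum>i\<in>I. \<Sum>j\<in>I. \<Sum>k\<in>I.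
      formal_scale (\<phi> i a * \<phi> j b * \<phi> k c) (gen (x i, x j, x k)))
    \<in> formal.span (tensor_relations3 scale N)"
proof -
  let ?W = "formal.span (tensor_relations3 scale N)"
  note W = formal.subspace_span[of "tensor_relations3 scale N"]
  have slot1: "gen (a, b, c) - (\<Sum>i\<in>I. formal_scale (\<phi> i a) (gen (x i, b, c))) \<in> ?W"
    if "a \<in> N" "b \<in> N" "c \<in> N" for a b c
  proof -
    have "gen ((\<Sum>i\<in>I. scale (\<phi> i a) (x i)), b, c) - (\<Sum>i\<in>I. formal_scale (\<phi> i a) (gen (x i, b, c))) \<in> ?W"
      by (rule linear_modulo_sum[OF N W, where g = "\<lambda>v. gen (v, b, c)"])
        (simp_all add: formal.span_base tensor_relations3_memI that x)
    then show ?thesis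
      by (simp only: expand[OF that(1), symmetric])
  qed
  have slot2: "gen (a, b, c) - (\<Sum>i\<in>I. formal_scale (\<phi> i b) (gen (a, x i, c))) \<in> ?W"
    if "a \<in> N" "b \<in> N" "c \<in> N" for a b c
  proof -
    have "gen (a, (\<Sum>i\<in>I. scale (\<phi> i b) (x i)), c) - (\<Sum>i\<in>I. formal_scale (\<phi> i b) (gen (a, x i, c))) \<in> ?W"
      by (rule linear_modulo_sum[OF N W, where g = "\<lambda>v. gen (a, v, c)"])
        (simp_all add: formal.span_base tensor_relations3_memI that x)
    then show ?thesis
      by (simp only: expand[OF that(2), symmetric])
  qed
  have slot3: "gen (a, b, c) - (\<Sum>i\<in>I. formal_scale (\<phi> i c) (gen (a, b, x i))) \<in> ?W"
    if "a \<in> N" "b \<in> N" "c \<in> N" for a b c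
  proof -
    have "gen (a, b, (\<Sum>i\<in>I. scale (\<phi> i c) (x i))) - (\<Sum>i\<in>I. formal_scale (\<phi> i c) (gen (a, b, x i))) \<in> ?W"
      by (rule linear_modulo_sum[OF N W, where g = "\<lambda>v. gen (a, b, v)"])
        (simp_all add: formal.span_base tensor_relations3_memI that x)
    then show ?thesis
      by (simp only: expand[OF that(3), symmetric])
  qed
  \<comment> \<open>Expanding one slot after the other, the three errors telescope.\<close>
  have "(gen (a, b, c) - (\<Sum>i\<in>I. formal_scale (\<phi> i a) (gen (x i, b, c))))
    + (\<Sum>i\<in>I. formal_scale (\<phi> i a)
        (gen (x i, b, c) - (\<Sum>j\<in>I. formal_scale (\<phi> j b) (gen (x i, x j, c)))))
    + (\<Sum>i\<in>I. \<Sum>j\<in>I. formal_scale (\<phi> i a * \<phi> j b)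
        (gen (x i, x j, c) - (\<Sum>k\<in>I. formal_scale (\<phi> k c) (gen (x i, x j, x k))))) \<in> ?W"
    by (intro formal.span_add formal.span_sum formal.span_scale slot1 slot2 slot3 abc x)
  then show ?thesis
    by (simp add: formal.scale_right_diff_distrib sum_subtractf formal.scale_sum_right mult.assoc)
qed

text \<open>
  If every vector of \<open>N\<close> is expanded as \<open>v = \<Sum> \<phi>\<^sub>i(v) x\<^sub>i\<close>, then expanding all three slots rewrites a threefold
  tensor \<open>u\<close> as \<open>\<Sum> (\<phi>\<^sub>i \<otimes> \<phi>\<^sub>j \<otimes> \<phi>\<^sub>k)(u) x\<^sub>i \<otimes> x\<^sub>j \<otimes> x\<^sub>k\<close>; so \<open>u\<close> is zero once these coefficients are. The \<open>x\<^sub>i\<close>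
  may be linearly dependent, which allows the legs of an arbitrary presentation of \<open>r\<close> to play this part.
\<close>

lemma (in vector_space) in_span_tensor_relations3:
  fixes \<phi> :: "'i \<Rightarrow> 'b \<Rightarrow> 'a"
  assumes N: "subspace N"
    and x: "\<And>i. i \<in> I \<Longrightarrow> x i \<in> N"
    and expand: "\<And>v. v \<in> N \<Longrightarrow> v = (\<Sum>i\<in>I. scale (\<phi> i v) (x i))"
    and u: "u \<in> formal_sums (N \<times> N \<times> N)"
    and zero: "\<And>i j k. i \<in> I \<Longrightarrow> j \<in> I \<Longrightarrow> k \<in> I \<Longrightarrow>
      formal_eval (\<lambda>(a, b, c). \<phi> i a * \<phi> j b * \<phi> k c) u = 0"
  shows "u \<in> formal.span (tensor_relations3 scale N)"
proof -
  let ?W = "formal.span (tensor_relations3 scale N)"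
  define E where "E t = (\<Sum>i\<in>I. \<Sum>j\<in>I. \<Sum>k\<in>I.
      formal_scale ((\<lambda>(a, b, c). \<phi> i a * \<phi> j b * \<phi> k c) t) (gen (x i, x j, x k)))" for t
  have "(\<Sum>t\<in>Poly_Mapping.keys u. formal_scale (Poly_Mapping.lookup u t) (gen t - E t)) \<in> ?W"
  proof (intro formal.span_sum formal.span_scale)
    fix t assume "t \<in> Poly_Mapping.keys u"
    then have "t \<in> N \<times> N \<times> N"
      using u by (auto simp: formal_sums_def)
    then show "gen t - E t \<in> ?W"
      unfolding E_def by (cases t) (simp add: gen_expansion3[OF N x expand])
  qed
  moreover have "(\<Sum>t\<in>Poly_Mapping.keys u. formal_scale (Poly_Mapping.lookup u t) (E t))
      = (\<Sum>i\<in>I. \<Sum>j\<in>I. \<Sum>k\<in>I.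
          formal_scale (formal_eval (\<lambda>(a, b, c). \<phi> i a * \<phi> j b * \<phi> k c) u) (gen (x i, x j, x k)))"
    unfolding E_def formal_eval_def formal.scale_sum_right formal.scale_sum_left formal.scale_scale
    by (subst sum.swap, rule sum.cong[OF refl], subst sum.swap, rule sum.cong[OF refl],
        subst sum.swap, rule sum.cong[OF refl], simp)
  moreover have "\<dots> = 0"
    by (simp add: zero)
  ultimately show ?thesis
    by (simp add: formal.scale_right_diff_distrib sum_subtractf formal_sum_expansion[symmetric])
qed

section \<open>The tensor inverse to a quasi-Frobenius form\<close>

lemma (in vector_space) functional_sum:
  fixes f :: "'b \<Rightarrow> 'a"
  assumes N: "subspace N"
    and add: "\<And>x y. x \<in> N \<Longrightarrow> y \<in> N \<Longrightarrow> f (x + y) = f x + f y"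
    and scl: "\<And>c x. x \<in> N \<Longrightarrow> f (scale c x) = c * f x"
    and x: "\<And>i. i \<in> I \<Longrightarrow> x i \<in> N"
  shows "f (\<Sum>i\<in>I. scale (c i) (x i)) = (\<Sum>i\<in>I. c i * f (x i))"
proof -
  have zero: "f 0 = 0"
    using scl[of 0 0] subspace_0[OF N] by simp
  show ?thesis
    using x
    by (induction I rule: infinite_finite_induct)
      (simp_all add: zero add scl subspace_sum[OF N] subspace_scale[OF N])
qed

lemma (in vector_space) bilinear_form_sum:
  fixes B :: "'b \<Rightarrow> 'b \<Rightarrow> 'a"
  assumes N: "subspace N" and B: "bilinear_on N scale (*) B"
    and x: "\<And>i. i \<in> I \<Longrightarrow> x i \<in> N" and y: "\<And>j. j \<in> J \<Longrightarrow> y j \<in> N"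
  shows "(\<Sum>i\<in>I. \<Sum>j\<in>J. c i * d j * B (x i) (y j))
    = B (\<Sum>i\<in>I. scale (c i) (x i)) (\<Sum>j\<in>J. scale (d j) (y j))"
proof -
  let ?x = "\<Sum>i\<in>I. scale (c i) (x i)" and ?y = "\<Sum>j\<in>J. scale (d j) (y j)"
  have y': "?y \<in> N"
    by (intro subspace_sum[OF N] subspace_scale[OF N] y)
  have "B ?x ?y = (\<Sum>i\<in>I. c i * B (x i) ?y)"
    by (rule functional_sum[OF N, where f = "\<lambda>v. B v ?y"])
      (use B x y' in \<open>auto simp: bilinear_on_def\<close>)
  also have "\<dots> = (\<Sum>i\<in>I. c i * (\<Sum>j\<in>J. d j * B (x i) (y j)))"
  proof (intro sum.cong refl arg_cong2[where f = "(*)"])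
    fix i assume "i \<in> I"
    then show "B (x i) ?y = (\<Sum>j\<in>J. d j * B (x i) (y j))"
      by (intro functional_sum[OF N]) (use B x y in \<open>auto simp: bilinear_on_def\<close>)
  qed
  finally show ?thesis
    by (simp add: sum_distrib_left mult.assoc)
qed

lemma sum_list_pairs_nth:
  "(\<Sum>(x, y)\<leftarrow>ps. f x y) = (\<Sum>i<length ps. f (fst (ps ! i)) (snd (ps ! i)))"
  by (simp add: sum_list_sum_nth atLeast0LessThan case_prod_beta)

text \<open>
  Indices in place of lists, so that the three kinds of terms can be contracted as double sums.
\<close>

lemma formal_eval_nybe_lhs:
  "formal_eval (\<lambda>(a, b, c). T a b c) (nybe_lhs mult ps)
    = (\<Sum>i<length ps. \<Sum>j<length ps.
        T (fst (ps ! i)) (fst (ps ! j)) (mult (snd (ps ! i)) (snd (ps ! j)))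
      + T (fst (ps ! i)) (mult (snd (ps ! i)) (fst (ps ! j)) + mult (fst (ps ! j)) (snd (ps ! i)))
          (snd (ps ! j))
      + T (mult (fst (ps ! i)) (fst (ps ! j))) (snd (ps ! j)) (snd (ps ! i)))"
  unfolding nybe_lhs_def
  by (simp add: sum_list_pairs_nth formal_eval_sum formal_eval_add)

context quasi_frobenius_novikov_algebra
begin

lemma form_linear:
  assumes "x \<in> N" "y \<in> N" "z \<in> N"
  shows "\<omega> (x + y) z = \<omega> x z + \<omega> y z" "\<omega> z (x + y) = \<omega> z x + \<omega> z y"
    "\<omega> (scale c x) z = c * \<omega> x z" "\<omega> z (scale c x) = c * \<omega> z x"
  using form_bilinear assms by (auto simp: bilinear_on_def)

lemma mult_linear:
  assumes "x \<in> N" "y \<in> N" "z \<in> N"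
  shows "mult (x + y) z = mult x z + mult y z" "mult z (x + y) = mult z x + mult z y"
    "mult (scale c x) z = scale c (mult x z)" "mult z (scale c x) = scale c (mult z x)"
  using mult_bilinear assms by (auto simp: bilinear_on_def)

lemma eq_if_form_eq:
  assumes "a \<in> N" "b \<in> N" and eq: "\<And>w. w \<in> N \<Longrightarrow> \<omega> w a = \<omega> w b"
  shows "a = b"
proof -
  have "\<omega> (a + scale (-1) b) w = 0" if "w \<in> N" for w
  proof -
    have "\<omega> (a + scale (-1) b) w = \<omega> a w - \<omega> b w"
      using assms that by (simp only: form_linear subspace_scale[OF subspace_carrier]) simp
    also have "\<dots> = 0"
      using eq[OF that] assms that form_skew[of a w] form_skew[of b w] by simp
    finally show ?thesis .
  qed
  then have "a + scale (-1) b = 0"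
    by (intro form_nondegenerate subspace_add[OF subspace_carrier] subspace_scale[OF subspace_carrier] assms)
  then show ?thesis
    by simp
qed

text \<open>
  The inverse of the form turns a leg of the tensor into an arbitrary vector, so that the contracted
  Yang-Baxter expression is the compatibility condition between form and product.
\<close>

lemma nybe_solution_inverse_form:
  assumes u: "u \<in> formal_sums (N \<times> N)"
    and inverse: "\<And>v w. v \<in> N \<Longrightarrow> w \<in> N \<Longrightarrow> formal_eval (\<lambda>(x, y). \<omega> v x * \<omega> w y) u = \<omega> v w"
  shows "nybe_solution scale N mult (tensor2 scale N u)"
  unfolding nybe_solution_def
proof (intro conjI allI impI; (elim conjE)?)
  show "tensor2 scale N u \<in> tensor_space2 scale N"
    unfolding tensor2_def tensor_space2_def using u by (rule quotientI)
next
  fix ps :: "('v \<times> 'v) list"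
  assume ps: "set ps \<subseteq> N \<times> N" and eq: "tensor2 scale N u = tensor2 scale N (formal_of_pairs ps)"
  define I where "I = {..<length ps}"
  define x where "x i = fst (ps ! i)" for i
  define y where "y i = snd (ps ! i)" for i
  have mem: "x i \<in> N" "y i \<in> N" if "i \<in> I" for i
    using subsetD[OF ps nth_mem, of i] that by (simp_all add: I_def x_def y_def mem_Times_iff)
  note closed = subspace_add[OF subspace_carrier] subspace_scale[OF subspace_carrier]
    subspace_sum[OF subspace_carrier] mult_closed
  have ps_formal: "formal_of_pairs ps \<in> formal_sums (N \<times> N)"
    unfolding formal_of_pairs_def using ps by (intro formal_sums_sum_list) auto
  have "(u, formal_of_pairs ps) \<in> tensor_eq2 scale N"
    using eq eq_equiv_class[OF _ equiv_tensor_eq2 ps_formal] unfolding tensor2_def by blast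
  then have same: "u - formal_of_pairs ps \<in> formal.span (tensor_relations2 scale N)"
    by (simp add: tensor_eq2_def)
  have inv: "(\<Sum>i\<in>I. \<omega> v (x i) * \<omega> w (y i)) = \<omega> v w" if "v \<in> N" "w \<in> N" for v w
  proof -
    have "bilinear_on N scale (*) (\<lambda>x y. \<omega> v x * \<omega> w y)"
      using that by (simp add: bilinear_on_def form_linear algebra_simps)
    from formal_eval_tensor_relations2[OF this same]
    have "formal_eval (\<lambda>(x, y). \<omega> v x * \<omega> w y) (formal_of_pairs ps) = \<omega> v w"
      by (simp add: formal_eval_diff inverse that)
    then show ?thesis
      unfolding formal_of_pairs_def formal_eval_sum_list formal_eval_gen sum_list_pairs_nth I_def x_def y_def .
  qed
  \<comment> \<open>Both expansions follow by pairing with a test vector, since the form is nondegenerate.\<close>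
  have expand_x: "(\<Sum>i\<in>I. scale (\<omega> w (y i)) (x i)) = w" if w: "w \<in> N" for w
  proof (rule eq_if_form_eq[OF _ w])
    fix v assume v: "v \<in> N"
    have "\<omega> v (\<Sum>i\<in>I. scale (\<omega> w (y i)) (x i)) = (\<Sum>i\<in>I. \<omega> w (y i) * \<omega> v (x i))"
      by (rule functional_sum[OF subspace_carrier]) (use v mem in \<open>auto simp: form_linear\<close>)
    then show "\<omega> v (\<Sum>i\<in>I. scale (\<omega> w (y i)) (x i)) = \<omega> v w"
      using inv[OF v w] by (simp add: mult.commute)
  qed (auto intro!: closed mem)
  have expand_y: "(\<Sum>i\<in>I. scale (\<omega> (x i) v) (y i)) = v" if v: "v \<in> N" for v
  proof (rule eq_if_form_eq[OF _ v])
    fix w assume w: "w \<in> N"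
    have "\<omega> w (\<Sum>i\<in>I. scale (\<omega> (x i) v) (y i)) = (\<Sum>i\<in>I. \<omega> (x i) v * \<omega> w (y i))"
      by (rule functional_sum[OF subspace_carrier]) (use w mem in \<open>auto simp: form_linear\<close>)
    also have "\<dots> = - (\<Sum>i\<in>I. \<omega> v (x i) * \<omega> w (y i))"
      unfolding sum_negf[symmetric] by (intro sum.cong refl) (simp add: form_skew[OF mem(1) v])
    also have "\<dots> = \<omega> w v"
      by (simp add: inv v w form_skew[OF w v])
    finally show "\<omega> w (\<Sum>i\<in>I. scale (\<omega> (x i) v) (y i)) = \<omega> w v" .
  qed (auto intro!: closed mem)
  have lhs_formal: "nybe_lhs mult ps \<in> formal_sums (N \<times> N \<times> N)"
    unfolding nybe_lhs_def using ps
    by (intro formal_sums_sum_list)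
      (auto intro!: formal_sums_sum_list formal.subspace_add[OF subspace_formal_sums] closed
        simp: subset_iff split: prod.splits)
  have "nybe_lhs mult ps \<in> formal.span (tensor_relations3 scale N)"
  proof (rule in_span_tensor_relations3[OF subspace_carrier mem(1) expand_x[symmetric] lhs_formal])
    \<comment> \<open>\<open>1\<close>, \<open>2\<close> and \<open>3\<close> contract the three kinds of terms; where the vector to be expanded stands on
      the wrong side of \<open>\<omega>\<close>, skewsymmetry is used first, once in \<open>2\<close> and twice in \<open>3\<close>.\<close>
    fix i j k assume "i \<in> I" "j \<in> I" "k \<in> I"
    then obtain p q s where pqs: "p = y i" "q = y j" "s = y k" "p \<in> N" "q \<in> N" "s \<in> N"
      using mem by blast
    have "(\<Sum>i\<in>I. \<Sum>j\<in>I. \<omega> (x i) p * \<omega> (x j) q * \<omega> (mult (y i) (y j)) s)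
      = \<omega> (mult (\<Sum>i\<in>I. scale (\<omega> (x i) p) (y i)) (\<Sum>j\<in>I. scale (\<omega> (x j) q) (y j))) s"
      by (rule bilinear_form_sum[OF subspace_carrier, where B = "\<lambda>a b. \<omega> (mult a b) s"])
        (use pqs mem in \<open>auto simp: bilinear_on_def form_linear mult_linear closed\<close>)
    then have 1: "(\<Sum>i\<in>I. \<Sum>j\<in>I. \<omega> (x i) p * \<omega> (x j) q * \<omega> (mult (y i) (y j)) s) = \<omega> (mult p q) s"
      by (simp add: expand_y pqs(4-))
    have "(\<Sum>i\<in>I. \<Sum>j\<in>I. \<omega> (x i) p * \<omega> s (y j) * \<omega> (mult (y i) (x j) + mult (x j) (y i)) q)
      = \<omega> (mult (\<Sum>i\<in>I. scale (\<omega> (x i) p) (y i)) (\<Sum>j\<in>I. scale (\<omega> s (y j)) (x j))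
          + mult (\<Sum>j\<in>I. scale (\<omega> s (y j)) (x j)) (\<Sum>i\<in>I. scale (\<omega> (x i) p) (y i))) q"
      by (rule bilinear_form_sum[OF subspace_carrier, where B = "\<lambda>a b. \<omega> (mult a b + mult b a) q"])
        (use pqs mem in \<open>auto simp: bilinear_on_def form_linear mult_linear closed algebra_simps\<close>)
    then have "(\<Sum>i\<in>I. \<Sum>j\<in>I. \<omega> (x i) p * \<omega> s (y j) * \<omega> (mult (y i) (x j) + mult (x j) (y i)) q)
      = \<omega> (mult p s + mult s p) q"
      by (simp add: expand_x expand_y pqs(4-))
    moreover have "(\<Sum>i\<in>I. \<Sum>j\<in>I.
        \<omega> (x i) p * \<omega> (mult (y i) (x j) + mult (x j) (y i)) q * \<omega> (y j) s)
      = - (\<Sum>i\<in>I. \<Sum>j\<in>I. \<omega> (x i) p * \<omega> s (y j) * \<omega> (mult (y i) (x j) + mult (x j) (y i)) q)"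
      unfolding sum_negf[symmetric]
      by (intro sum.cong refl) (simp add: form_skew[OF mem(2) pqs(6)])
    ultimately have 2: "(\<Sum>i\<in>I. \<Sum>j\<in>I.
        \<omega> (x i) p * \<omega> (mult (y i) (x j) + mult (x j) (y i)) q * \<omega> (y j) s)
      = - \<omega> (mult p s + mult s p) q"
      by simp
    have "(\<Sum>i\<in>I. \<Sum>j\<in>I. \<omega> s (y i) * \<omega> q (y j) * \<omega> (mult (x i) (x j)) p)
      = \<omega> (mult (\<Sum>i\<in>I. scale (\<omega> s (y i)) (x i)) (\<Sum>j\<in>I. scale (\<omega> q (y j)) (x j))) p"
      by (rule bilinear_form_sum[OF subspace_carrier, where B = "\<lambda>a b. \<omega> (mult a b) p"])
        (use pqs mem in \<open>auto simp: bilinear_on_def form_linear mult_linear closed\<close>)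
    then have "(\<Sum>i\<in>I. \<Sum>j\<in>I. \<omega> s (y i) * \<omega> q (y j) * \<omega> (mult (x i) (x j)) p) = \<omega> (mult s q) p"
      by (simp add: expand_x pqs(4-))
    moreover have "(\<Sum>i\<in>I. \<Sum>j\<in>I. \<omega> (mult (x i) (x j)) p * \<omega> (y j) q * \<omega> (y i) s)
      = (\<Sum>i\<in>I. \<Sum>j\<in>I. \<omega> s (y i) * \<omega> q (y j) * \<omega> (mult (x i) (x j)) p)"
      by (intro sum.cong refl) (simp add: form_skew[OF mem(2) pqs(5)] form_skew[OF mem(2) pqs(6)])
    ultimately have 3: "(\<Sum>i\<in>I. \<Sum>j\<in>I. \<omega> (mult (x i) (x j)) p * \<omega> (y j) q * \<omega> (y i) s)
      = \<omega> (mult s q) p"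
      by simp
    have "formal_eval (\<lambda>(a, b, c). \<omega> a p * \<omega> b q * \<omega> c s) (nybe_lhs mult ps)
      = \<omega> (mult p q) s - \<omega> (mult p s + mult s p) q + \<omega> (mult s q) p"
      unfolding formal_eval_nybe_lhs[where T = "\<lambda>a b c. \<omega> a p * \<omega> b q * \<omega> c s"]
      using 1 2 3 by (simp only: sum.distrib x_def y_def I_def add_uminus_conv_diff)
    then show "formal_eval (\<lambda>(a, b, c). \<omega> a (y i) * \<omega> b (y j) * \<omega> c (y k)) (nybe_lhs mult ps) = 0"
      using form_compatible[of p q s] pqs by simp
  qed
  then have "(nybe_lhs mult ps, 0) \<in> tensor_eq3 scale N"
    using lhs_formal by (simp add: tensor_eq3_def formal_sums_def)
  then show "tensor3 scale N (nybe_lhs mult ps) = tensor3 scale N 0"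
    unfolding tensor3_def by (rule equiv_class_eq[OF equiv_tensor_eq3])
qed

end

section \<open>Skewsymmetric tensors\<close>

lemma lookup_map_key_swap:
  "Poly_Mapping.lookup (Poly_Mapping.map_key prod.swap u) x = Poly_Mapping.lookup u (prod.swap x)"
  by (simp add: map_key.rep_eq)

lemma map_key_swap_linear:
  "Poly_Mapping.map_key prod.swap (u + v) = Poly_Mapping.map_key prod.swap u + Poly_Mapping.map_key prod.swap v"
  "Poly_Mapping.map_key prod.swap (u - v) = Poly_Mapping.map_key prod.swap u - Poly_Mapping.map_key prod.swap v"
  "Poly_Mapping.map_key prod.swap (- u) = - Poly_Mapping.map_key prod.swap u"
  "Poly_Mapping.map_key prod.swap (formal_scale c u) = formal_scale c (Poly_Mapping.map_key prod.swap u)"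
  "Poly_Mapping.map_key prod.swap (\<Sum>i\<in>I. w i) = (\<Sum>i\<in>I. Poly_Mapping.map_key prod.swap (w i))"
  by (rule poly_mapping_eqI, simp add: lookup_map_key_swap lookup_add lookup_minus lookup_sum)+

lemma map_key_swap_gen: "Poly_Mapping.map_key prod.swap (gen (x, y)) = gen (y, x)"
  using map_key_single[OF inj_swap, of "(y, x)"] by simp

lemma map_key_swap_formal_sums:
  assumes "u \<in> formal_sums (N \<times> N)"
  shows "Poly_Mapping.map_key prod.swap u \<in> formal_sums (N \<times> N)"
  using assms by (auto simp: formal_sums_def keys_map_key)

lemma tensor_relations2_memI:
  assumes "x \<in> N" "y \<in> N"
  shows "x' \<in> N \<Longrightarrow> gen (x + x', y) - gen (x, y) - gen (x', y) \<in> tensor_relations2 s N"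
    and "y' \<in> N \<Longrightarrow> gen (x, y + y') - gen (x, y) - gen (x, y') \<in> tensor_relations2 s N"
    and "gen (s c x, y) - formal_scale c (gen (x, y)) \<in> tensor_relations2 s N"
    and "gen (x, s c y) - formal_scale c (gen (x, y)) \<in> tensor_relations2 s N"
  unfolding tensor_relations2_def Un_iff mem_Collect_eq
  subgoal by (rule disjI1, rule disjI1, rule disjI1, intro exI conjI, rule refl, simp_all add: assms)
  subgoal by (rule disjI1, rule disjI1, rule disjI2, intro exI conjI, rule refl, simp_all add: assms)
  subgoal by (rule disjI1, rule disjI2, intro exI conjI, rule refl, simp_all add: assms)
  subgoal by (rule disjI2, intro exI conjI, rule refl, simp_all add: assms)
  done

lemma map_key_swap_span:
  assumes "u \<in> formal.span (tensor_relations2 s N)"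
  shows "Poly_Mapping.map_key prod.swap u \<in> formal.span (tensor_relations2 s N)"
  using assms
proof (induction rule: formal.span_induct_alt)
  case base
  show ?case
    by (simp add: formal.span_zero)
next
  case (step c w v)
  from step.hyps have "Poly_Mapping.map_key prod.swap w \<in> tensor_relations2 s N"
    by (subst (asm) tensor_relations2_def)
      (auto simp: map_key_swap_linear map_key_swap_gen tensor_relations2_memI)
  then show ?case
    using step.IH
    by (simp add: map_key_swap_linear formal.span_add formal.span_scale formal.span_base)
qed

text \<open>
  Minus the flip is an involution that preserves the relations. If it fixes one representative of a
  tensor, it therefore maps the whole coset onto itself, which is skewsymmetry.
\<close>

lemma skewsymmetric_tensor2:
  assumes u: "u \<in> formal_sums (N \<times> N)" and skew: "Poly_Mapping.map_key prod.swap u = - u"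
  shows "skewsymmetric_tensor (tensor2 s N u)"
proof -
  let ?\<tau> = "\<lambda>v. - Poly_Mapping.map_key prod.swap v"
  have closed: "?\<tau> v \<in> tensor2 s N u" if "v \<in> tensor2 s N u" for v
  proof -
    from that have v: "v \<in> formal_sums (N \<times> N)" "u - v \<in> formal.span (tensor_relations2 s N)"
      by (auto simp: tensor2_def tensor_eq2_def)
    have "- Poly_Mapping.map_key prod.swap (u - v) \<in> formal.span (tensor_relations2 s N)"
      by (intro formal.span_neg map_key_swap_span v)
    moreover have "?\<tau> v \<in> formal_sums (N \<times> N)"
      by (intro formal.subspace_neg[OF subspace_formal_sums] map_key_swap_formal_sums v)
    ultimately show ?thesis
      using u by (simp add: tensor2_def tensor_eq2_def map_key_swap_linear skew add.commute)
  qed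
  have involution: "Poly_Mapping.map_key prod.swap (?\<tau> v) = - v" for v
    by (rule poly_mapping_eqI) (simp add: lookup_map_key_swap)
  show ?thesis
    unfolding skewsymmetric_tensor_def
  proof (intro equalityI subsetI)
    fix w assume "w \<in> Poly_Mapping.map_key prod.swap ` tensor2 s N u"
    then obtain v where "v \<in> tensor2 s N u" "w = Poly_Mapping.map_key prod.swap v"
      by blast
    then show "w \<in> uminus ` tensor2 s N u"
      using closed[of v] by (intro image_eqI[of _ _ "?\<tau> v"]) auto
  next
    fix w assume "w \<in> uminus ` tensor2 s N u"
    then obtain v where "v \<in> tensor2 s N u" "w = - v"
      by blast
    then show "w \<in> Poly_Mapping.map_key prod.swap ` tensor2 s N u"
      using closed[of v] involution[of v] by (intro image_eqI[of _ _ "?\<tau> v"]) auto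
  qed
qed

section \<open>The semidirect product with the dual space\<close>

lemma dual_space_iff:
  assumes "vector_space scale"
  shows "f \<in> dual_space scale \<longleftrightarrow>
    (\<forall>x y. f (x + y) = f x + f y) \<and> (\<forall>c x. f (scale c x) = c * f x)"
  using assms vector_space_field by (auto simp: dual_space_def Vector_Spaces.linear_iff)

lemma dual_semidirect_mult_apply:
  "dual_semidirect_mult lhd rhd (a, f) (b, g)
    = (lhd a b + rhd a b, \<lambda>x. f (lhd x b) - g (rhd a x) - g (lhd x a))"
  by (simp add: dual_semidirect_mult_def semidirect_mult_def assoc_mult_def dual_action_def
      Let_def fun_eq_iff)

context vector_space
begin

lemma vector_space_direct_sum: "vector_space (direct_sum_scale scale)"
  by unfold_locales (auto simp: direct_sum_scale_def scale_right_distrib scale_left_distrib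
      algebra_simps fun_eq_iff)

lemma functional_linear:
  assumes "f \<in> dual_space scale"
  shows "f (x + y) = f x + f y" "f (x - y) = f x - f y" "f (- x) = - f x" "f 0 = 0"
    "f (scale c x) = c * f x"
proof -
  interpret f: Vector_Spaces.linear scale "(*)" f
    using assms by (simp add: dual_space_def)
  show "f (x + y) = f x + f y" "f (x - y) = f x - f y" "f (- x) = - f x" "f 0 = 0"
    "f (scale c x) = c * f x"
    by (rule f.add f.diff f.neg f.zero f.scale)+
qed

text \<open>
  A nonzero vector extends to a basis, so some functional takes the value \<open>1\<close> on it. This gives half of
  the nondegeneracy of the pairing on \<open>A \<oplus> A\<^sup>*\<close>.
\<close>

lemma dual_space_separates_points:
  assumes "\<And>f. f \<in> dual_space scale \<Longrightarrow> f a = 0"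
  shows "a = 0"
proof (rule ccontr)
  interpret pair: vector_space_pair scale "(*) :: 'a \<Rightarrow> 'a \<Rightarrow> 'a"
    by (intro vector_space_pair.intro vector_space_axioms vector_space_field)
  assume "a \<noteq> 0"
  then have "independent {a}"
    by simp
  from pair.linear_independent_extend[OF this, of "\<lambda>_. 1"]
  obtain f where "Vector_Spaces.linear scale (*) f" "f a = 1"
    by auto
  with assms[of f] show False
    by (simp add: dual_space_def)
qed

end

context pre_novikov_algebra
begin

lemma lhd_linear:
  "(x + y) \<lhd> z = x \<lhd> z + y \<lhd> z" "x \<lhd> (y + z) = x \<lhd> y + x \<lhd> z"
  "scale c x \<lhd> y = scale c (x \<lhd> y)" "x \<lhd> scale c y = scale c (x \<lhd> y)"
  using lhd_bilinear by (auto simp: bilinear_on_def)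

lemma rhd_linear:
  "(x + y) \<rhd> z = x \<rhd> z + y \<rhd> z" "x \<rhd> (y + z) = x \<rhd> y + x \<rhd> z"
  "scale c x \<rhd> y = scale c (x \<rhd> y)" "x \<rhd> scale c y = scale c (x \<rhd> y)"
  using rhd_bilinear by (auto simp: bilinear_on_def)

text \<open>
  The axiom \<open>add_rhd\<close> solved for one term, so that it can be used as a rewrite rule after products of
  sums have been expanded.
\<close>

lemma lhd_add_rhd: "(x \<lhd> y) \<rhd> z = (x \<rhd> z) \<lhd> y - (x \<rhd> y) \<rhd> z"
  using add_rhd[of x y z] by (simp add: rhd_linear algebra_simps)

lemma dual_action_closed:
  assumes "f \<in> dual_space scale" "g \<in> dual_space scale"
  shows "(\<lambda>x. f (x \<lhd> b) - g (a \<rhd> x) - g (x \<lhd> a)) \<in> dual_space scale"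
  unfolding dual_space_iff[OF vector_space_axioms]
  by (simp add: lhd_linear rhd_linear functional_linear[OF assms(1)] functional_linear[OF assms(2)]
      algebra_simps)

lemma subspace_direct_sum_dual:
  "module.subspace (direct_sum_scale scale) (direct_sum_dual scale)"
proof -
  interpret D: vector_space "direct_sum_scale scale"
    by (rule vector_space_direct_sum)
  show ?thesis
    by (rule D.subspaceI)
      (auto simp: direct_sum_dual_def direct_sum_scale_def dual_space_iff[OF vector_space_axioms]
        zero_prod_def algebra_simps)
qed

text \<open>
  In the second component of the two Novikov identities every functional is evaluated at products of
  two elements of \<open>A\<close> and the argument \<open>x\<close>. Rewriting by the axioms, at the instances that occur, brings
  these arguments on both sides to a common form. Compatibility of the form with the product reduces,
  one functional at a time, to \<open>a \<circ> b = a \<lhd> b + a \<rhd> b\<close>.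
\<close>

theorem quasi_frobenius_semidirect_dual:
  "quasi_frobenius_novikov_algebra (direct_sum_scale scale) (direct_sum_dual scale)
     (dual_semidirect_mult (\<lhd>) (\<rhd>)) dual_pairing_form"
proof -
  interpret D: vector_space "direct_sum_scale scale"
    by (rule vector_space_direct_sum)
  note unfolds = direct_sum_dual_def direct_sum_scale_def dual_semidirect_mult_apply
    dual_pairing_form_def
  show ?thesis
  proof unfold_locales
    show "D.subspace (direct_sum_dual scale)"
      by (rule subspace_direct_sum_dual)
  next
    fix a b :: "'a \<times> ('a \<Rightarrow> 'k)"
    assume "a \<in> direct_sum_dual scale" "b \<in> direct_sum_dual scale"
    then show "dual_semidirect_mult (\<lhd>) (\<rhd>) a b \<in> direct_sum_dual scale"
      by (auto simp: unfolds dual_action_closed)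
  next
    show "bilinear_on (direct_sum_dual scale) (direct_sum_scale scale) (direct_sum_scale scale)
      (dual_semidirect_mult (\<lhd>) (\<rhd>))"
      unfolding bilinear_on_def
      by (auto simp: unfolds lhd_linear rhd_linear functional_linear scale_right_distrib
          fun_eq_iff algebra_simps)
  next
    fix u v w :: "'a \<times> ('a \<Rightarrow> 'k)"
    assume "u \<in> direct_sum_dual scale" "v \<in> direct_sum_dual scale" "w \<in> direct_sum_dual scale"
    then obtain a f b g c h where uvw: "u = (a, f)" "v = (b, g)" "w = (c, h)"
      and dual: "f \<in> dual_space scale" "g \<in> dual_space scale" "h \<in> dual_space scale"
      by (auto simp: direct_sum_dual_def)
    note lin = lhd_linear rhd_linear functional_linear[OF dual(1)] functional_linear[OF dual(2)]
      functional_linear[OF dual(3)]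
    show "dual_semidirect_mult (\<lhd>) (\<rhd>) (dual_semidirect_mult (\<lhd>) (\<rhd>) u v) w
      - dual_semidirect_mult (\<lhd>) (\<rhd>) u (dual_semidirect_mult (\<lhd>) (\<rhd>) v w)
      = dual_semidirect_mult (\<lhd>) (\<rhd>) (dual_semidirect_mult (\<lhd>) (\<rhd>) v u) w
      - dual_semidirect_mult (\<lhd>) (\<rhd>) v (dual_semidirect_mult (\<lhd>) (\<rhd>) u w)"
      by (simp add: uvw dual_semidirect_mult_apply fun_eq_iff lin rhd_rhd[of a b] lhd_add_rhd[of a b]
          lhd_add_rhd[of b a] rhd_lhd[of a b] rhd_lhd[of b a] rhd_lhd[of a _ c] rhd_lhd[of b _ c]
          rhd_lhd[of a _ b] rhd_lhd[of b _ a] lhd_lhd[of _ c a] lhd_lhd[of _ c b] lhd_lhd[of _ b a]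
          algebra_simps)
    show "dual_semidirect_mult (\<lhd>) (\<rhd>) (dual_semidirect_mult (\<lhd>) (\<rhd>) u v) w
      = dual_semidirect_mult (\<lhd>) (\<rhd>) (dual_semidirect_mult (\<lhd>) (\<rhd>) u w) v"
      by (simp add: uvw dual_semidirect_mult_apply fun_eq_iff lin lhd_add_rhd[of a b] lhd_add_rhd[of a c]
          rhd_lhd[of a _ b] rhd_lhd[of a _ c] lhd_lhd[of _ c a] lhd_lhd[of _ b a] lhd_lhd[of _ c b]
          algebra_simps)
    show "dual_pairing_form (dual_semidirect_mult (\<lhd>) (\<rhd>) u v) w
      - dual_pairing_form (dual_semidirect_mult (\<lhd>) (\<rhd>) u w + dual_semidirect_mult (\<lhd>) (\<rhd>) w u) v
      + dual_pairing_form (dual_semidirect_mult (\<lhd>) (\<rhd>) w v) u = 0"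
      by (simp add: uvw unfolds lin)
  next
    show "bilinear_on (direct_sum_dual scale) (direct_sum_scale scale) (*) dual_pairing_form"
      unfolding bilinear_on_def
      by (auto simp: unfolds functional_linear algebra_simps)
  next
    fix u v :: "'a \<times> ('a \<Rightarrow> 'k)"
    show "dual_pairing_form u v = - dual_pairing_form v u"
      by (simp add: dual_pairing_form_def split: prod.split)
  next
    fix u :: "'a \<times> ('a \<Rightarrow> 'k)"
    assume u: "u \<in> direct_sum_dual scale"
      and zero: "\<And>v. v \<in> direct_sum_dual scale \<Longrightarrow> dual_pairing_form u v = 0"
    obtain a f where af: "u = (a, f)"
      by (cases u)
    have f: "f \<in> dual_space scale"
      using u by (simp add: af direct_sum_dual_def)
    have zero_dual: "0 \<in> dual_space scale"
      by (simp add: dual_space_iff[OF vector_space_axioms])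
    have "a = 0"
    proof (rule dual_space_separates_points)
      fix g assume "g \<in> dual_space scale"
      then show "g a = 0"
        using zero[of "(0, g)"] by (simp add: af unfolds functional_linear[OF f])
    qed
    moreover have "f b = 0" for b
      using zero[of "(b, 0)"] zero_dual by (simp add: af unfolds)
    ultimately show "u = 0"
      by (simp add: af zero_prod_def fun_eq_iff)
  qed
qed

end

section \<open>The canonical tensor\<close>

lemma (in finite_dimensional_vector_space) functional_dual_basis:
  assumes inj: "inj_on e I" and basis: "e ` I = Basis"
    and e_dual: "\<And>i. i \<in> I \<Longrightarrow> e_dual i \<in> dual_space scale"
    and dual: "\<And>i j. i \<in> I \<Longrightarrow> j \<in> I \<Longrightarrow> e_dual i (e j) = (if i = j then 1 else 0)"
    and f: "f \<in> dual_space scale"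
  shows "f a = (\<Sum>i\<in>I. e_dual i a * f (e i))"
proof -
  have fin: "finite I"
    using finite_imageD[OF _ inj] finite_Basis by (simp add: basis)
  have "a \<in> span Basis"
    by (simp add: span_Basis)
  then show ?thesis
  proof (induction rule: span_induct_alt)
    case base
    show ?case
      by (simp add: functional_linear(4)[OF f] functional_linear(4)[OF e_dual])
  next
    case (step c x y)
    then obtain j where j: "j \<in> I" "x = e j"
      using basis by blast
    have "(\<Sum>i\<in>I. e_dual i (scale c x + y) * f (e i))
      = c * (\<Sum>i\<in>I. e_dual i x * f (e i)) + (\<Sum>i\<in>I. e_dual i y * f (e i))"
      by (simp add: functional_linear[OF e_dual] sum_distrib_left sum.distrib algebra_simps)
    also have "(\<Sum>i\<in>I. e_dual i x * f (e i)) = (\<Sum>i\<in>I. if i = j then f (e i) else 0)"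
      by (intro sum.cong refl) (simp add: j dual)
    also have "\<dots> = f x"
      using fin j by simp
    finally show ?case
      by (simp add: functional_linear[OF f] step.IH)
  qed
qed

text \<open>
  For \<open>v = (a, f)\<close> and \<open>w = (b, g)\<close>, the summands \<open>- e\<^sub>i\<^sup>* \<otimes> e\<^sub>i\<close> contribute \<open>\<Sum> e\<^sub>i\<^sup>*(a) g(e\<^sub>i) = g(a)\<close> and the
  summands \<open>e\<^sub>i \<otimes> e\<^sub>i\<^sup>*\<close> contribute \<open>- \<Sum> f(e\<^sub>i) e\<^sub>i\<^sup>*(b) = - f(b)\<close>.
\<close>

lemma (in finite_dimensional_vector_space) canonical_tensor_inverts_pairing:
  fixes e :: "'i \<Rightarrow> 'b"
  assumes inj: "inj_on e I" and basis: "e ` I = Basis"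
    and e_dual: "\<And>i. i \<in> I \<Longrightarrow> e_dual i \<in> dual_space scale"
    and dual: "\<And>i j. i \<in> I \<Longrightarrow> j \<in> I \<Longrightarrow> e_dual i (e j) = (if i = j then 1 else 0)"
    and v: "v \<in> direct_sum_dual scale" and w: "w \<in> direct_sum_dual scale"
  shows "formal_eval (\<lambda>(x, y). dual_pairing_form v x * dual_pairing_form w y)
      (\<Sum>i\<in>I. gen ((e i, 0), (0, e_dual i)) - gen ((0, e_dual i), (e i, 0)))
    = dual_pairing_form v w"
proof -
  obtain a f b g where vw: "v = (a, f)" "w = (b, g)" and fg: "f \<in> dual_space scale" "g \<in> dual_space scale"
    using v w by (auto simp: direct_sum_dual_def)
  have "dual_pairing_form v w = (\<Sum>i\<in>I. e_dual i a * g (e i)) - (\<Sum>i\<in>I. e_dual i b * f (e i))"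
    unfolding vw dual_pairing_form_def
    using functional_dual_basis[OF inj basis e_dual dual fg(1), of b]
      functional_dual_basis[OF inj basis e_dual dual fg(2), of a] by simp
  then show ?thesis
    by (simp add: vw dual_pairing_form_def formal_eval_sum formal_eval_diff functional_linear(4)[OF fg(1)]
        functional_linear(4)[OF fg(2)] sum_subtractf sum_negf algebra_simps)
qed

theorem theorem3p35:
  fixes scale :: "'k::field_char_0 \<Rightarrow> 'a::ab_group_add \<Rightarrow> 'a"
    and lhd rhd :: "'a \<Rightarrow> 'a \<Rightarrow> 'a"
    and n :: nat
    and e :: "nat \<Rightarrow> 'a"
    and e_dual :: "nat \<Rightarrow> 'a \<Rightarrow> 'k"
  assumes "pre_novikov_algebra scale lhd rhd"
    and "finite_dimensional_vector_space scale (e ` {1..n})"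
    and "inj_on e {1..n}"
    and "\<And>i. i \<in> {1..n} \<Longrightarrow> e_dual i \<in> dual_space scale"
    and "\<And>i j. i \<in> {1..n} \<Longrightarrow> j \<in> {1..n} \<Longrightarrow> e_dual i (e j) = (if i = j then 1 else 0)"
  shows "let N = direct_sum_dual scale;
             S = direct_sum_scale scale;
             mult = dual_semidirect_mult lhd rhd;
             r = tensor2 S N (\<Sum>\<alpha> = 1..n. gen ((e \<alpha>, 0), (0, e_dual \<alpha>))
                                            - gen ((0, e_dual \<alpha>), (e \<alpha>, 0)))
         in skewsymmetric_tensor r \<and> nybe_solution S N mult r \<and>
            quasi_frobenius_novikov_algebra S N mult dual_pairing_form"
proof -
  interpret A: pre_novikov_algebra scale lhd rhd
    by fact
  interpret V: finite_dimensional_vector_space scale "e ` {1..n}"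
    by fact
  interpret Q: quasi_frobenius_novikov_algebra "direct_sum_scale scale" "direct_sum_dual scale"
    "dual_semidirect_mult lhd rhd" dual_pairing_form
    by (rule A.quasi_frobenius_semidirect_dual)
  let ?N = "direct_sum_dual scale"
  let ?u = "\<Sum>\<alpha> = 1..n. gen ((e \<alpha>, 0), (0, e_dual \<alpha>)) - gen ((0, e_dual \<alpha>), (e \<alpha>, 0))"
  have mem: "(e i, 0) \<in> ?N" "(0, e_dual i) \<in> ?N" if "i \<in> {1..n}" for i
    using assms(4)[OF that] by (auto simp: direct_sum_dual_def dual_space_iff[OF A.vector_space_axioms])
  have u: "?u \<in> formal_sums (?N \<times> ?N)"
    using mem by (intro formal.subspace_sum[OF subspace_formal_sums]
        formal.subspace_diff[OF subspace_formal_sums]) auto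
  have "Poly_Mapping.map_key prod.swap ?u = - ?u"
    by (simp add: map_key_swap_linear map_key_swap_gen flip: sum_negf)
  then have "skewsymmetric_tensor (tensor2 (direct_sum_scale scale) ?N ?u)"
    by (rule skewsymmetric_tensor2[OF u])
  moreover have "nybe_solution (direct_sum_scale scale) ?N (dual_semidirect_mult lhd rhd)
      (tensor2 (direct_sum_scale scale) ?N ?u)"
    by (rule Q.nybe_solution_inverse_form[OF u])
      (rule V.canonical_tensor_inverts_pairing[OF assms(3) refl assms(4) assms(5)])
  ultimately show ?thesis
    using Q.quasi_frobenius_novikov_algebra_axioms by (simp only: Let_def simp_thms)
qed

end
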